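(* Let $k\ge0$ and let $T$ be a unilateral weighted shift with weight sequence $0_k\oplus\{\alpha_n\}_{n\ge1}$, where $\{|\alpha_n|\}$ is an eventually constant sequence of nonzero numbers. Then $\mathcal S(T,T^* )$ is an SI semigroup if and only if $\{|\alpha_n|\}$ has the form $(a,1,1,\dots)$. Moreover, in this situation $\mathcal S(T,T^* )$ is simple.
   Context: For an orthonormal basis $\{e_n\}_{n\ge1}$ of a Hilbert space $\mathcal H$, the weighted shift with bounded complex weights $\{\beta_n\}$ is the operator with $Te_n=\beta_ne_{n+1}$, $n\ge1$. The sequence $0_k\oplus\{\alpha_n\}$ consists of $k$ zeros followed by $\alpha_1,\alpha_2,\dots$. A sequence $\{\beta_n\}$ is eventually constant if there are $N\ge1$ and $\beta$ with $\beta_j=\beta$ for all $j\ge N$. $\mathcal S(T,T^* )$ is the multiplicative semigroup of all finite nonempty products of $T$ and $T^*$. An ideal of a semigroup $\mathcal S$ is a nonempty subset $J\subset\mathcal S$ with $XA,AX\in J$ for $A\in J$, $X\in\mathcal S$. $\mathcal S$ is simple if its only ideal is $\mathcal S$ itself. $\mathcal S$ is an SI (selfadjoint-ideal) semigroup if every ideal $J$ of $\mathcal S$ satisfies $J^*=\{A^*:A\in J\}\subset J$. *)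

theory Defs
  imports "HOL-Analysis.Analysis"
begin

text \<open>Complex inner product spaces are built on top of the real ones, so that norm, topology,
  completeness and real bounded linearity are those of HOL-Analysis. The complex inner product is
  linear in its first argument; its real part is the underlying real inner product, hence
  \<open>norm x = sqrt (Re (cinner x x))\<close>.\<close>

class complex_inner = real_inner +
  fixes scaleC :: "complex \<Rightarrow> 'a \<Rightarrow> 'a" (infixr "*\<^sub>C" 75)
    and cinner :: "'a \<Rightarrow> 'a \<Rightarrow> complex"
  assumes scaleC_add_right: "c *\<^sub>C (x + y) = c *\<^sub>C x + c *\<^sub>C y"
    and scaleC_add_left: "(c + d) *\<^sub>C x = c *\<^sub>C x + d *\<^sub>C x"
    and scaleC_scaleC: "c *\<^sub>C d *\<^sub>C x = (c * d) *\<^sub>C x"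
    and scaleR_scaleC: "scaleR r x = complex_of_real r *\<^sub>C x"
    and cinner_commute: "cinner x y = cnj (cinner y x)"
    and cinner_add_left: "cinner (x + y) z = cinner x z + cinner y z"
    and cinner_scaleC_left: "cinner (c *\<^sub>C x) y = c * cinner x y"
    and inner_Re_cinner: "inner x y = Re (cinner x y)"

class complex_hilbert_space = complex_inner + complete_space

lemma scaleC_one: "1 *\<^sub>C x = (x :: 'a::complex_inner)"
  using scaleR_scaleC[of 1 x] by simp

global_interpretation complex_vector: vector_space "scaleC :: complex \<Rightarrow> 'a \<Rightarrow> 'a::complex_inner"
  by unfold_locales (simp_all add: scaleC_add_right scaleC_add_left scaleC_scaleC scaleC_one)

definition bounded_operator :: "('a::complex_inner \<Rightarrow> 'a) \<Rightarrow> bool" where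
  "bounded_operator A \<longleftrightarrow> bounded_linear A \<and> (\<forall>c x. A (c *\<^sub>C x) = c *\<^sub>C A x)"

text \<open>Meaningful for operators that possess an adjoint, in particular for all bounded operators
  on a Hilbert space; see \<open>cadjoint_eqI\<close> for uniqueness.\<close>

definition cadjoint :: "('a::complex_inner \<Rightarrow> 'a) \<Rightarrow> 'a \<Rightarrow> 'a" where
  "cadjoint A = (THE B. \<forall>x y. cinner (A x) y = cinner x (B y))"

lemma cadjoint_eqI:
  fixes A B :: "'a::complex_inner \<Rightarrow> 'a"
  assumes B: "\<And>x y. cinner (A x) y = cinner x (B y)"
  shows "cadjoint A = B"
  unfolding cadjoint_def
proof (rule the_equality)
  show "\<forall>x y. cinner (A x) y = cinner x (B y)" using B by blast
next
  fix C assume C: "\<forall>x y. cinner (A x) y = cinner x (C y)"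
  show "C = B"
  proof
    fix y
    have "\<forall>x. inner x (C y) = inner x (B y)"
      using B C by (simp add: inner_Re_cinner)
    then have "inner (C y - B y) (C y - B y) = 0" by (simp add: inner_diff_right)
    then show "C y = B y" by simp
  qed
qed

definition orthonormal_basis :: "(nat \<Rightarrow> 'a::complex_inner) \<Rightarrow> bool" where
  "orthonormal_basis e \<longleftrightarrow>
     (\<forall>m n. cinner (e m) (e n) = (if m = n then 1 else 0)) \<and>
     closure (complex_vector.span (range e)) = UNIV"

text \<open>All sequences are indexed from 0: \<open>e n\<close>, \<open>\<beta> n\<close> and \<open>\<alpha> n\<close> stand for the mathematical
  $e_{n+1}$, $\beta_{n+1}$ and $\alpha_{n+1}$.\<close>

definition weighted_shift :: "(nat \<Rightarrow> 'a::complex_inner) \<Rightarrow> (nat \<Rightarrow> complex) \<Rightarrow> ('a \<Rightarrow> 'a) \<Rightarrow> bool" where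
  "weighted_shift e \<beta> T \<longleftrightarrow>
     orthonormal_basis e \<and> bounded (range \<beta>) \<and> bounded_operator T \<and>
     (\<forall>n. T (e n) = \<beta> n *\<^sub>C e (Suc n))"

definition zeros_then :: "nat \<Rightarrow> (nat \<Rightarrow> complex) \<Rightarrow> nat \<Rightarrow> complex" where
  "zeros_then k \<alpha> n = (if n < k then 0 else \<alpha> (n - k))"

definition eventually_constant :: "(nat \<Rightarrow> 'b) \<Rightarrow> bool" where
  "eventually_constant s \<longleftrightarrow> (\<exists>N c. \<forall>j\<ge>N. s j = c)"

inductive_set adjoint_semigroup :: "('a::complex_inner \<Rightarrow> 'a) \<Rightarrow> ('a \<Rightarrow> 'a) set"
  for T :: "'a \<Rightarrow> 'a" where
  self: "T \<in> adjoint_semigroup T"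
| adj: "cadjoint T \<in> adjoint_semigroup T"
| prod: "A \<in> adjoint_semigroup T \<Longrightarrow> B \<in> adjoint_semigroup T \<Longrightarrow> A \<circ> B \<in> adjoint_semigroup T"

definition semigroup_ideal :: "('a \<Rightarrow> 'a) set \<Rightarrow> ('a \<Rightarrow> 'a) set \<Rightarrow> bool" where
  "semigroup_ideal S J \<longleftrightarrow>
     J \<noteq> {} \<and> J \<subseteq> S \<and> (\<forall>A\<in>J. \<forall>X\<in>S. X \<circ> A \<in> J \<and> A \<circ> X \<in> J)"

definition simple_semigroup :: "('a \<Rightarrow> 'a) set \<Rightarrow> bool" where
  "simple_semigroup S \<longleftrightarrow> (\<forall>J. semigroup_ideal S J \<longrightarrow> J = S)"

definition SI_semigroup :: "('a::complex_inner \<Rightarrow> 'a) set \<Rightarrow> bool" where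
  "SI_semigroup S \<longleftrightarrow> (\<forall>J. semigroup_ideal S J \<longrightarrow> cadjoint ` J \<subseteq> J)"

end

theory Submission
  imports Defs
begin

text \<open>Write \<open>s\<close> for the adjoint of \<open>T\<close>. If the moduli of the weights are \<open>(a, 1, 1, \<dots>)\<close>, then
  \<open>s T T = T\<close> and \<open>s s T = s\<close>. These two relations alone give, for every word \<open>A\<close>, positive
  exponents with \<open>A T^p = T^q\<close>, hence \<open>s^(q-1) A T^p = T\<close>, so every ideal contains \<open>T\<close> and
  \<open>s = s s T\<close>.

  Conversely, the words that contain the letter \<open>T\<close> form an ideal, so in an SI semigroup \<open>s\<close> equals
  such a word \<open>w\<close>. Following \<open>w\<close> along the basis from the \<open>n\<close>-th vector, the modulus of the
  \<open>(n-1)\<close>-st weight must equal the product of the moduli of the weights met on the way. For large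
  \<open>n\<close> this forces the eventual constant to be \<open>1\<close>. If the last modulus different from \<open>1\<close> had index
  \<open>N \<ge> 1\<close>, the cases \<open>n = N + 1\<close> and \<open>n = N\<close> would show that the path crosses its first edge downwards
  exactly once and its first edge upwards never, which leaves only \<open>w = s\<close>.\<close>

section \<open>Adjoints\<close>

text \<open>The source of adjoints: it supplies the witness that makes the \<open>THE\<close> in
  \<open>cadjoint\<close> denote a genuine adjoint of a bounded operator.\<close>

lemma riesz_representation_real:
  fixes \<phi> :: "'a::{real_inner,complete_space} \<Rightarrow> real"
  assumes "bounded_linear \<phi>"
  shows "\<exists>z. \<forall>x. \<phi> x = inner x z"
proof -
  interpret \<phi>: bounded_linear \<phi> by fact
  \<comment> \<open>The representing vector is the minimiser of this functional.\<close>
  define q where "q x = inner x x - 2 * \<phi> x" for x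
  obtain K where K: "\<And>x. norm (\<phi> x) \<le> norm x * K"
    using \<phi>.bounded by blast
  have lower: "- (K\<^sup>2) \<le> q x" for x
  proof -
    have "0 \<le> (norm x - K)\<^sup>2" by simp
    moreover have "\<phi> x \<le> norm x * K" using K[of x] by simp
    ultimately show ?thesis
      by (simp add: q_def power2_norm_eq_inner[symmetric] power2_diff)
  qed
  have bdd: "bdd_below (range q)" using lower by (intro bdd_belowI) auto
  define m where "m = Inf (range q)"
  have m_le: "m \<le> q x" for x unfolding m_def by (intro cInf_lower bdd) simp
  have "\<exists>x. q x < m + inverse (real (Suc n))" for n
    using cInf_lessD[of "range q" "m + inverse (real (Suc n))"] by (auto simp: m_def)
  then obtain X where X: "\<And>n. q (X n) < m + inverse (real (Suc n))" by metis
  \<comment> \<open>Parallelogram law, with the value of \<open>q\<close> at the midpoint bounded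
    below by \<open>m\<close>; it makes minimising sequences Cauchy.\<close>
  have par: "(norm (x - y))\<^sup>2 \<le> 2 * (q x - m) + 2 * (q y - m)" for x y
  proof -
    have "q ((1/2) *\<^sub>R (x + y)) = inner (x + y) (x + y) / 4 - (\<phi> x + \<phi> y)"
      by (simp add: q_def \<phi>.scaleR \<phi>.add add_divide_distrib flip: scaleR_add_right)
    then have "4 * q ((1/2) *\<^sub>R (x + y)) + (norm (x - y))\<^sup>2 = 2 * q x + 2 * q y"
      by (simp add: q_def power2_norm_eq_inner inner_add_left inner_add_right
          inner_diff_left inner_diff_right inner_commute algebra_simps)
    with m_le[of "(1/2) *\<^sub>R (x + y)"] show ?thesis by simp
  qed
  have "Cauchy X"
  proof (rule metric_CauchyI)
    fix r :: real assume "0 < r"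
    then obtain M where M: "4 * inverse (real (Suc M)) < r\<^sup>2"
      using reals_Archimedean[of "r\<^sup>2 / 4"] by (auto simp: mult.commute)
    have "dist (X i) (X j) < r" if "M \<le> i" "M \<le> j" for i j
    proof -
      have "4 * (q (X l) - m) < r\<^sup>2" if "M \<le> l" for l
      proof -
        have "inverse (real (Suc l)) \<le> inverse (real (Suc M))"
          using that by (intro le_imp_inverse_le) auto
        then show ?thesis using X[of l] M by argo
      qed
      from this[OF that(1)] this[OF that(2)] have "(norm (X i - X j))\<^sup>2 < r\<^sup>2"
        using par[of "X i" "X j"] by (simp add: algebra_simps)
      then show ?thesis
        using \<open>0 < r\<close> by (simp add: dist_norm power_less_imp_less_base)
    qed
    then show "\<exists>M. \<forall>i\<ge>M. \<forall>j\<ge>M. dist (X i) (X j) < r" by blast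
  qed
  then obtain z where z: "X \<longlonglongrightarrow> z" using Cauchy_convergent convergent_def by blast
  have "(\<lambda>n. q (X n)) \<longlonglongrightarrow> q z"
    unfolding q_def by (intro tendsto_intros z \<phi>.tendsto)
  moreover have "(\<lambda>n. m + inverse (real (Suc n))) \<longlonglongrightarrow> m + 0"
    by (intro tendsto_intros LIMSEQ_inverse_real_of_nat)
  ultimately have qz: "q z \<le> m"
    using X by (intro LIMSEQ_le[of _ "q z" _ m]) (auto intro: less_imp_le)
  have "\<phi> x = inner x z" for x
  proof -
    define d where "d = inner x z - \<phi> x"
    \<comment> \<open>Since \<open>q (z - t x) = q z - 2 t d + t^2 |x|^2\<close>, minimality forces
      this \<open>t\<close> to vanish; the \<open>+ 1\<close> keeps the denominator positive at
      \<open>x = 0\<close>.\<close>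
    define t where "t = d / (inner x x + 1)"
    have pos: "0 < inner x x + 1" by (simp add: add_nonneg_pos)
    have "q z \<le> q (z - t *\<^sub>R x)" using qz m_le order_trans by blast
    then have "2 * t * d \<le> t\<^sup>2 * inner x x"
      by (simp add: q_def d_def \<phi>.diff \<phi>.scaleR inner_diff_left inner_diff_right
          inner_commute power2_eq_square algebra_simps)
    moreover have "t * d = t\<^sup>2 * (inner x x + 1)"
      using pos by (simp add: t_def power2_eq_square)
    ultimately have "t\<^sup>2 * (inner x x + 2) \<le> 0" by (simp add: algebra_simps)
    moreover have "0 < inner x x + 2" using pos by simp
    ultimately have "t = 0"
      by (metis mult_le_0_iff not_le power2_less_eq_zero_iff zero_le_power2)
    with pos show ?thesis by (simp add: t_def d_def)
  qed
  then show ?thesis by blast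
qed

lemma cinner_zero_left [simp]: "cinner 0 x = 0"
  using cinner_add_left[of 0 0 x] by simp

lemma cinner_zero_right [simp]: "cinner x 0 = 0"
  using cinner_commute[of x 0] by simp

lemma cinner_add_right: "cinner x (y + z) = cinner x y + cinner x z"
  by (metis cinner_add_left cinner_commute complex_cnj_add)

lemma cinner_scaleC_right: "cinner x (c *\<^sub>C y) = cnj c * cinner x y"
  by (metis cinner_scaleC_left cinner_commute complex_cnj_mult)

lemma cinner_cadjoint:
  fixes A :: "'a::complex_hilbert_space \<Rightarrow> 'a"
  assumes "bounded_operator A"
  shows "cinner (A x) y = cinner x (cadjoint A y)"
proof -
  have A: "bounded_linear A" and A_scaleC: "\<And>c x. A (c *\<^sub>C x) = c *\<^sub>C A x"
    using assms by (auto simp: bounded_operator_def)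
  have "\<exists>z. \<forall>x. inner (A x) y = inner x z" for y
    using riesz_representation_real[OF bounded_linear_compose[OF bounded_linear_inner_left A]] .
  then obtain B where B: "\<And>x y. inner (A x) y = inner x (B y)" by metis
  have "cinner (A x) y = cinner x (B y)" for x y
    \<comment> \<open>The vector \<open>x\<close> gives the real parts, its multiple by
      \<open>\<i>\<close> the imaginary parts.\<close>
    using B[of x y] B[of "\<i> *\<^sub>C x" y]
    by (simp add: complex_eq_iff inner_Re_cinner A_scaleC cinner_scaleC_left)
  then show ?thesis using cadjoint_eqI[of A B] by metis
qed

text \<open>The difference is orthogonal to the span of the basis, by continuity to its closure, and
  so to itself.\<close>

lemma orthonormal_basis_eqI:
  fixes x y :: "'a::complex_inner"
  assumes "orthonormal_basis e" and "\<And>n. cinner x (e n) = cinner y (e n)"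
  shows "x = y"
proof -
  define z where "z = x - y"
  have "x = z + y" by (simp add: z_def)
  then have 0: "cinner z (e n) = 0" for n
    using assms(2)[of n] by (simp add: cinner_add_left)
  have "cinner z v = 0" if "v \<in> complex_vector.span (range e)" for v
    using that
    by (induction rule: complex_vector.span_induct_alt)
      (auto simp: 0 cinner_add_right cinner_scaleC_right)
  then have "complex_vector.span (range e) \<subseteq> {v. inner z v = 0}"
    by (auto simp: inner_Re_cinner)
  moreover have "closed {v. inner z v = 0}"
    by (intro closed_Collect_eq continuous_intros)
  ultimately have "closure (complex_vector.span (range e)) \<subseteq> {v. inner z v = 0}"
    by (rule closure_minimal)
  then have "z \<in> {v. inner z v = 0}"
    using assms(1) unfolding orthonormal_basis_def by blast
  then show ?thesis by (simp add: z_def)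
qed

section \<open>The shift and its adjoint on basis vectors\<close>

locale weighted_shift_operator =
  fixes e :: "nat \<Rightarrow> 'a::complex_hilbert_space" and \<beta> :: "nat \<Rightarrow> complex" and T :: "'a \<Rightarrow> 'a"
  assumes shift: "weighted_shift e \<beta> T"
begin

lemma basis: "orthonormal_basis e"
  and operator: "bounded_operator T"
  and shift_basis: "T (e n) = \<beta> n *\<^sub>C e (Suc n)"
  using shift by (simp_all add: weighted_shift_def)

lemma cinner_basis: "cinner (e m) (e n) = (if m = n then 1 else 0)"
  using basis by (simp add: orthonormal_basis_def)

lemmas cinner_shift = cinner_cadjoint[OF operator]

lemma cinner_adjoint: "cinner (cadjoint T x) y = cinner x (T y)"
  by (metis cinner_commute cinner_shift)

lemma shift_scaleC: "T (c *\<^sub>C x) = c *\<^sub>C T x"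
  using operator by (simp add: bounded_operator_def)

lemma adjoint_scaleC: "cadjoint T (c *\<^sub>C x) = c *\<^sub>C cadjoint T x"
  by (rule orthonormal_basis_eqI[OF basis]) (simp add: cinner_adjoint cinner_scaleC_left)

lemma adjoint_basis_0: "cadjoint T (e 0) = 0"
  by (rule orthonormal_basis_eqI[OF basis])
    (simp add: cinner_adjoint shift_basis cinner_scaleC_right cinner_basis)

lemma adjoint_basis_Suc: "cadjoint T (e (Suc n)) = cnj (\<beta> n) *\<^sub>C e n"
  by (rule orthonormal_basis_eqI[OF basis])
    (simp add: cinner_adjoint shift_basis cinner_scaleC_left cinner_scaleC_right cinner_basis)

lemma adjoint_semigroup_cadjoint:
  assumes "A \<in> adjoint_semigroup T"
  shows "cadjoint A \<in> adjoint_semigroup T"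
proof -
  \<comment> \<open>The induction carries an explicit adjoint inside the semigroup, reversing
    products; uniqueness then identifies it with \<open>cadjoint A\<close>.\<close>
  from assms have "\<exists>B\<in>adjoint_semigroup T. \<forall>x y. cinner (A x) y = cinner x (B y)"
  proof induction
    case self
    then show ?case using cinner_shift adjoint_semigroup.adj by blast
  next
    case adj
    then show ?case using cinner_adjoint adjoint_semigroup.self by blast
  next
    case (prod A B)
    then obtain A' B' where "A' \<in> adjoint_semigroup T" "B' \<in> adjoint_semigroup T"
      and "\<And>x y. cinner (A x) y = cinner x (A' y)" "\<And>x y. cinner (B x) y = cinner x (B' y)"
      by blast
    then show ?case
      by (intro bexI[of _ "B' \<circ> A'"]) (auto intro: adjoint_semigroup.prod)
  qed
  then show ?thesis using cadjoint_eqI by metis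
qed

lemma simple_imp_SI:
  assumes "simple_semigroup (adjoint_semigroup T)"
  shows "SI_semigroup (adjoint_semigroup T)"
  using assms adjoint_semigroup_cadjoint unfolding simple_semigroup_def SI_semigroup_def by blast

end

section \<open>Simplicity\<close>

lemma funpow_in_adjoint_semigroup:
  assumes "A \<in> adjoint_semigroup T"
  shows "A ^^ Suc n \<in> adjoint_semigroup T"
  using assms by (induction n) (auto intro: adjoint_semigroup.prod)

lemma adjoint_semigroup_right_power:
  assumes "A \<in> adjoint_semigroup T" and "cadjoint T \<circ> T \<circ> T = T"
  shows "\<exists>p q. A \<circ> T ^^ Suc p = T ^^ Suc q"
  using assms(1)
proof induction
  case self
  have "T \<circ> T ^^ Suc 0 = T ^^ Suc (Suc 0)" by simp
  then show ?case by blast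
next
  case adj
  \<comment> \<open>The square is essential: an adjoint cancels a \<open>T\<close> only when another
    \<open>T\<close> follows.\<close>
  have "cadjoint T \<circ> T ^^ Suc (Suc 0) = T ^^ Suc 0" using assms(2) by (simp add: comp_assoc)
  then show ?case by blast
next
  case (prod A B)
  then obtain p q p' q' where A: "A \<circ> T ^^ Suc p' = T ^^ Suc q'"
    and B: "B \<circ> T ^^ Suc p = T ^^ Suc q"
    by blast
  \<comment> \<open>\<open>B\<close> consumes the first block of \<open>T\<close>s; the remaining
    block commutes past the resulting power and is then consumed by \<open>A\<close>.\<close>
  have "A \<circ> B \<circ> T ^^ Suc (p + Suc p') = A \<circ> (B \<circ> T ^^ Suc p) \<circ> T ^^ Suc p'"
    using funpow_add[of "Suc p" "Suc p'" T] by (simp only: add_Suc comp_assoc)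
  also have "\<dots> = A \<circ> T ^^ Suc p' \<circ> T ^^ Suc q"
    unfolding B using funpow_add[of "Suc p'" "Suc q" T] funpow_add[of "Suc q" "Suc p'" T]
    by (simp only: comp_assoc add.commute)
  also have "\<dots> = T ^^ Suc (q' + Suc q)"
    unfolding A using funpow_add[of "Suc q'" "Suc q" T] by (simp only: add_Suc)
  finally show ?case by blast
qed

lemma simple_adjoint_semigroupI:
  assumes stt: "cadjoint T \<circ> T \<circ> T = T" and sst: "cadjoint T \<circ> cadjoint T \<circ> T = cadjoint T"
  shows "simple_semigroup (adjoint_semigroup T)"
  unfolding simple_semigroup_def
proof (intro allI impI)
  fix J assume "semigroup_ideal (adjoint_semigroup T) J"
  then have sub: "J \<subseteq> adjoint_semigroup T" and "J \<noteq> {}"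
    and left: "\<And>X A. A \<in> J \<Longrightarrow> X \<in> adjoint_semigroup T \<Longrightarrow> X \<circ> A \<in> J"
    and right: "\<And>X A. A \<in> J \<Longrightarrow> X \<in> adjoint_semigroup T \<Longrightarrow> A \<circ> X \<in> J"
    by (auto simp: semigroup_ideal_def)
  from \<open>J \<noteq> {}\<close> obtain A where A: "A \<in> J" by blast
  then obtain p q where pq: "A \<circ> T ^^ Suc p = T ^^ Suc q"
    using sub adjoint_semigroup_right_power[OF _ stt] by blast
  have power: "T ^^ Suc q \<in> J"
    unfolding pq[symmetric] by (intro right A funpow_in_adjoint_semigroup adjoint_semigroup.self)
  have T: "T \<in> J" using power
  \<comment> \<open>Each left factor \<open>cadjoint T\<close> lowers the exponent by one, down to
    \<open>T\<close> itself.\<close>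
  proof (induction q)
    case (Suc q)
    have "cadjoint T \<circ> T ^^ Suc (Suc q) = T ^^ Suc q"
      using arg_cong[OF stt, of "\<lambda>f. f \<circ> T ^^ q"] by (simp add: comp_assoc)
    with Suc show ?case using left adjoint_semigroup.adj by metis
  qed simp
  have "cadjoint T \<in> J"
    using left[OF T adjoint_semigroup.prod[OF adjoint_semigroup.adj adjoint_semigroup.adj]]
    by (simp only: sst)
  have "A \<in> J" if "A \<in> adjoint_semigroup T" for A
    using that
  proof induction
    case (prod A B)
    then show ?case using left by blast
  qed fact+
  with sub show "J = adjoint_semigroup T" by blast
qed

context weighted_shift_operator
begin

text \<open>The hypothesis constrains a weight only if its predecessor is nonzero. With weights
  \<open>0_k\<close> followed by \<open>\<alpha>\<close>, this leaves the first
  \<open>\<alpha>\<close> free, whether \<open>k = 0\<close> or not.\<close>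

lemma simple_if_weights:
  assumes weights: "\<And>n. \<beta> n = 0 \<or> cmod (\<beta> (Suc n)) = 1"
  shows "simple_semigroup (adjoint_semigroup T)"
proof (rule simple_adjoint_semigroupI)
  have \<beta>: "cnj (\<beta> (Suc n)) * (\<beta> (Suc n) * \<beta> n) = \<beta> n" for n
    using weights[of n] complex_norm_square[of "\<beta> (Suc n)"] by (auto simp: ac_simps)
  have \<beta>': "\<beta> (Suc n) * (cnj (\<beta> (Suc n)) * cnj (\<beta> n)) = cnj (\<beta> n)" for n
    using arg_cong[OF \<beta>[of n], of cnj] by simp
  have stt: "cadjoint T (T (T (e n))) = T (e n)" for n
    using \<beta>[of n]
    by (simp add: shift_basis shift_scaleC adjoint_scaleC adjoint_basis_Suc scaleC_scaleC ac_simps)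
  have sst: "cadjoint T (cadjoint T (T (e n))) = cadjoint T (e n)" for n
  proof (cases n)
    case 0
    then show ?thesis
      by (simp add: shift_basis adjoint_scaleC adjoint_basis_Suc adjoint_basis_0)
  next
    case (Suc m)
    then show ?thesis using \<beta>'[of m]
      by (simp add: shift_basis adjoint_scaleC adjoint_basis_Suc scaleC_scaleC ac_simps)
  qed
  show "cadjoint T \<circ> T \<circ> T = T"
  proof
    fix x
    show "(cadjoint T \<circ> T \<circ> T) x = T x"
      \<comment> \<open>Moving all letters across the inner product reverses the word, so each
        identity follows from the other one on basis vectors.\<close>
      by (rule orthonormal_basis_eqI[OF basis]) (simp add: cinner_adjoint cinner_shift sst)
  qed
  show "cadjoint T \<circ> cadjoint T \<circ> T = cadjoint T"
  proof
    fix x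
    show "(cadjoint T \<circ> cadjoint T \<circ> T) x = cadjoint T x"
      by (rule orthonormal_basis_eqI[OF basis]) (simp add: cinner_adjoint cinner_shift stt)
  qed
qed

end

section \<open>Words in \<open>T\<close> and its adjoint\<close>

text \<open>Containing the letter \<open>T\<close> is a property of a word, not of the operator it
  represents; hence the explicit syntax.\<close>

primrec word_op :: "('a::complex_inner \<Rightarrow> 'a) \<Rightarrow> bool list \<Rightarrow> 'a \<Rightarrow> 'a" where
  "word_op T [] = id"
| "word_op T (b # w) = (if b then T else cadjoint T) \<circ> word_op T w"

lemma word_op_append: "word_op T (u @ v) = word_op T u \<circ> word_op T v"
  by (induction u) (auto simp: comp_assoc)

lemma word_op_in_adjoint_semigroup:
  "w \<noteq> [] \<Longrightarrow> word_op T w \<in> adjoint_semigroup T"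
proof (induction w)
  case (Cons b w)
  then show ?case
    by (cases "w = []"; cases b)
      (auto intro: adjoint_semigroup.intros simp del: comp_apply simp: comp_def[symmetric])
qed simp

lemma adjoint_semigroup_word:
  assumes "A \<in> adjoint_semigroup T"
  shows "\<exists>w. A = word_op T w"
  using assms
proof induction
  case self
  have "T = word_op T [True]" by simp
  then show ?case by blast
next
  case adj
  have "cadjoint T = word_op T [False]" by simp
  then show ?case by blast
next
  case (prod A B)
  then show ?case by (metis word_op_append)
qed

lemma SI_adjoint_word:
  assumes "SI_semigroup (adjoint_semigroup T)"
  shows "\<exists>w. True \<in> set w \<and> cadjoint T = word_op T w"
proof -
  define J where "J = {word_op T w | w. True \<in> set w}"
  have "X \<circ> A \<in> J \<and> A \<circ> X \<in> J" if A: "A \<in> J" and X: "X \<in> adjoint_semigroup T" for A X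
  proof -
    obtain w where w: "A = word_op T w" "True \<in> set w" using A by (auto simp: J_def)
    obtain v where v: "X = word_op T v" using adjoint_semigroup_word[OF X] by blast
    have "X \<circ> A = word_op T (v @ w)" "A \<circ> X = word_op T (w @ v)"
      by (simp_all add: w v word_op_append)
    moreover have "True \<in> set (v @ w)" "True \<in> set (w @ v)" using w(2) by simp_all
    ultimately show ?thesis unfolding J_def by blast
  qed
  moreover have T: "T \<in> J" unfolding J_def by (rule CollectI, rule exI[of _ "[True]"]) simp
  moreover have "J \<subseteq> adjoint_semigroup T"
    by (auto simp: J_def intro!: word_op_in_adjoint_semigroup)
  ultimately have "semigroup_ideal (adjoint_semigroup T) J" by (auto simp: semigroup_ideal_def)
  then have "cadjoint T \<in> J" using assms T by (auto simp: SI_semigroup_def)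
  then show ?thesis by (auto simp: J_def)
qed

text \<open>A word acts on basis vectors as a lattice path read from its right end: \<open>word_deg\<close> is its total
  displacement, and \<open>word_levels\<close> lists the edges it crosses, relative to the starting point, the edge
  between \<open>h\<close> and \<open>h + 1\<close> being numbered \<open>h\<close>.\<close>

primrec word_deg :: "bool list \<Rightarrow> int" where
  "word_deg [] = 0"
| "word_deg (b # w) = word_deg w + (if b then 1 else - 1)"

primrec word_levels :: "bool list \<Rightarrow> int list" where
  "word_levels [] = []"
| "word_levels (b # w) = (if b then word_deg w else word_deg w - 1) # word_levels w"

lemma word_deg_append: "word_deg (u @ v) = word_deg u + word_deg v"
  by (induction u) auto

lemma word_levels_append:
  "word_levels (u @ v) = map (\<lambda>h. h + word_deg v) (word_levels u) @ word_levels v"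
  by (induction u) (auto simp: word_deg_append)

lemma length_word_levels [simp]: "length (word_levels w) = length w"
  by (induction w) auto

text \<open>The first step cannot go up across edge 0, so it goes down across edge -1. A second step
  would cross edge -2 or edge -1 again.\<close>

lemma word_levels_single_descent:
  assumes "\<forall>h\<in>set (word_levels w). - 1 \<le> h" and "0 \<notin> set (word_levels w)"
    and "count_list (word_levels w) (- 1) = 1"
  shows "True \<notin> set w"
proof (cases w rule: rev_cases)
  case (snoc u b)
  with assms(2) have b: "\<not> b" by (auto simp: word_levels_append)
  show ?thesis
  proof (cases u rule: rev_cases)
    case Nil
    with snoc b show ?thesis by simp
  next
    case (snoc u' b')
    with \<open>w = u @ [b]\<close> b assms(1,3) show ?thesis
      by (cases b') (auto simp: word_levels_append)
  qed
qed simp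

lemma prod_list_map_two_points:
  fixes a b :: "'a::comm_monoid_mult"
  assumes "x \<noteq> y"
  shows "prod_list (map (\<lambda>h. if h = x then a else if h = y then b else 1) xs) =
    a ^ count_list xs x * b ^ count_list xs y"
  using assms by (induction xs) (auto simp: ac_simps)

section \<open>Self-adjoint ideals determine the weights\<close>

text \<open>The numerical core: \<open>G\<close> models the moduli of the weights, and
  \<open>eq\<close> compares the coefficients of \<open>word_op T w\<close> and
  \<open>cadjoint T\<close> at the \<open>n\<close>-th basis vector.\<close>

lemma weights_eq_1:
  fixes G :: "int \<Rightarrow> real"
  assumes neg: "\<And>j. j < 0 \<Longrightarrow> G j = 0" and pos: "\<And>j. 0 \<le> j \<Longrightarrow> 0 < G j"
    and const: "\<And>j. M \<le> j \<Longrightarrow> G j = c"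
    and w: "True \<in> set w" "w \<noteq> [True]"
    and eq: "\<And>n. 1 \<le> n \<Longrightarrow> prod_list (map (\<lambda>h. G (n + h)) (word_levels w)) = G (n - 1)"
  shows "1 \<le> j \<Longrightarrow> G j = 1"
proof -
  define L where "L = word_levels w"
  \<comment> \<open>From \<open>n = 1\<close>, a path below edge -1 would meet a zero weight, but
    \<open>G 0\<close> is positive.\<close>
  have low: "- 1 \<le> h" if "h \<in> set L" for h
  proof (rule ccontr)
    assume "\<not> - 1 \<le> h"
    then have "G (1 + h) = 0" by (intro neg) simp
    with that have "prod_list (map (\<lambda>h. G (1 + h)) L) = 0"
      by (auto simp: prod_list_zero_iff image_iff)
    with eq[of 1] pos[of 0] show False by (simp add: L_def)
  qed
  have "c = 1"
  proof -
    \<comment> \<open>As levels are at least -1, all edges met from this height lie in the constant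
      range.\<close>
    define n where "n = max 1 (M + 1)"
    have "map (\<lambda>h. G (n + h)) L = map (\<lambda>_. c) L"
      using low by (intro map_cong refl const) (force simp: n_def)
    then have "c ^ length w = c"
      using eq[of n] const[of "n - 1"] by (simp add: L_def n_def map_replicate_const prod_list_replicate)
    moreover have "0 < c" using const[of "max 0 M"] pos[of "max 0 M"] by simp
    moreover have "length w \<noteq> 0" "length w \<noteq> 1"
      using w by (auto simp: length_Suc_conv)
    ultimately have "c ^ (length w - 1) = 1" "length w - 1 \<noteq> 0"
      using \<open>c ^ length w = c\<close> by (cases "length w"; simp)+
    with \<open>0 < c\<close> show ?thesis using power_eq_iff_eq_base[of "length w - 1" c 1] by simp
  qed
  show "G j = 1" if "1 \<le> j"
  proof (rule ccontr)
    assume "G j \<noteq> 1"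
    define N where "N = Max {i \<in> {1..M}. G i \<noteq> 1}"
    have fin: "finite {i \<in> {1..M}. G i \<noteq> 1}" by (rule finite_subset[of _ "{1..M}"]) auto
    have "j \<in> {i \<in> {1..M}. G i \<noteq> 1}"
      using \<open>G j \<noteq> 1\<close> that const[of j] \<open>c = 1\<close> by force
    then have "N \<in> {i \<in> {1..M}. G i \<noteq> 1}"
      unfolding N_def by (intro Max_in fin) blast
    then have N: "1 \<le> N" "G N \<noteq> 1" by auto
    have above: "G i = 1" if "N < i" for i
    proof (rule ccontr)
      assume "G i \<noteq> 1"
      then have "i \<in> {i \<in> {1..M}. G i \<noteq> 1}" using that N const[of i] \<open>c = 1\<close> by force
      then have "i \<le> N" unfolding N_def by (intro Max_ge fin)
      with that show False by simp
    qed
    \<comment> \<open>From height \<open>N\<close> on, every edge above level 0 has weight 1, so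
      only levels -1 and 0 contribute.\<close>
    have prod: "G (n - 1) ^ count_list L (- 1) * G n ^ count_list L 0 = G (n - 1)" if "N \<le> n" for n
    proof -
      have "map (\<lambda>h. G (n + h)) L =
          map (\<lambda>h. if h = - 1 then G (n - 1) else if h = 0 then G n else 1) L"
        using low above that by (intro map_cong refl) force
      then show ?thesis
        using eq[of n] that N(1) by (simp only: L_def[symmetric] prod_list_map_two_points)
    qed
    have "G N ^ count_list L (- 1) = G N" using prod[of "N + 1"] above[of "N + 1"] by simp
    then have "G N ^ count_list L (- 1) = G N ^ 1" by simp
    then have one: "count_list L (- 1) = 1"
      using N pos[of N] by (subst (asm) power_inject_exp') auto
    \<comment> \<open>The factor \<open>G (N - 1)\<close> cancels because \<open>N \<ge> 1\<close>
      makes it positive.\<close>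
    have "G N ^ count_list L 0 = 1"
      using prod[of N] one pos[of "N - 1"] N by simp
    then have "count_list L 0 = 0"
      using N pos[of N] power_eq_iff_eq_base[of "count_list L 0" "G N" 1] by auto
    then have "0 \<notin> set L" by (simp add: count_list_0_iff)
    then show False using word_levels_single_descent[of w] low one w(1) by (simp add: L_def)
  qed
qed

context weighted_shift_operator
begin

text \<open>Both directions across an edge contribute the same modulus, so \<open>cmod c\<close>
  depends only on the edges crossed.\<close>

lemma word_op_basis:
  fixes F :: "int \<Rightarrow> 'a" and g :: "int \<Rightarrow> complex"
  assumes up: "\<And>j. T (F j) = g j *\<^sub>C F (j + 1)"
    and down: "\<And>j. cadjoint T (F j) = cnj (g (j - 1)) *\<^sub>C F (j - 1)"
  shows "\<exists>c. word_op T w (F n) = c *\<^sub>C F (n + word_deg w) \<and>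
    cmod c = prod_list (map (\<lambda>h. cmod (g (n + h))) (word_levels w))"
proof (induction w)
  case Nil
  then show ?case by (intro exI[of _ 1]) (simp add: scaleC_one)
next
  case (Cons b w)
  then obtain c where c: "word_op T w (F n) = c *\<^sub>C F (n + word_deg w)"
    "cmod c = prod_list (map (\<lambda>h. cmod (g (n + h))) (word_levels w))"
    by blast
  show ?case
  proof (cases b)
    case True
    then show ?thesis
      by (intro exI[of _ "c * g (n + word_deg w)"])
        (simp add: c shift_scaleC up scaleC_scaleC norm_mult algebra_simps)
  next
    case False
    then show ?thesis
      by (intro exI[of _ "c * cnj (g (n + word_deg w - 1))"])
        (simp add: c adjoint_scaleC down scaleC_scaleC norm_mult algebra_simps)
  qed
qed

end

lemma SI_imp_weights:
  fixes e :: "nat \<Rightarrow> 'a::complex_hilbert_space"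
  assumes "weighted_shift e (zeros_then k \<alpha>) T"
    and const: "eventually_constant (\<lambda>n. cmod (\<alpha> n))"
    and nonzero: "\<And>n. cmod (\<alpha> n) \<noteq> 0"
    and SI: "SI_semigroup (adjoint_semigroup T)"
  shows "cmod (\<alpha> (Suc n)) = 1"
proof -
  interpret weighted_shift_operator e "zeros_then k \<alpha>" T by unfold_locales fact
  \<comment> \<open>Extending by zero to negative indices lets words act without boundary cases.\<close>
  define g where "g j = (if j < 0 then 0 else \<alpha> (nat j))" for j
  define F where "F j = (if j < 0 then 0 else e (k + nat j))" for j
  have T0: "T 0 = 0" using shift_scaleC[of 0 0] by simp
  have s0: "cadjoint T 0 = 0" using adjoint_scaleC[of 0 0] by simp
  have up: "T (F j) = g j *\<^sub>C F (j + 1)" for j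
    by (auto simp: F_def g_def T0 shift_basis zeros_then_def nat_add_distrib)
  have down: "cadjoint T (F j) = cnj (g (j - 1)) *\<^sub>C F (j - 1)" for j
  proof -
    consider "j < 0" | "j = 0" | i where "j = 1 + int i"
      by (metis add.commute linorder_cases pos_int_cases zless_iff_Suc_zadd
          add_0 of_nat_Suc plus_1_eq_Suc)
    then show ?thesis
    proof cases
      \<comment> \<open>Both sides vanish: for \<open>k = 0\<close> the adjoint kills
        \<open>e 0\<close>, otherwise the weight just below is one of the leading zeros.\<close>
      case 2
      then show ?thesis
        by (cases k) (auto simp: F_def g_def adjoint_basis_0 adjoint_basis_Suc zeros_then_def)
    next
      case 3
      have "cadjoint T (F j) = cadjoint T (e (Suc (k + i)))"
        using 3 by (simp add: F_def nat_add_distrib)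
      also have "\<dots> = cnj (g (j - 1)) *\<^sub>C F (j - 1)"
        using 3 by (simp add: F_def g_def adjoint_basis_Suc zeros_then_def)
      finally show ?thesis .
    qed (simp add: F_def s0)
  qed
  obtain w where w: "True \<in> set w" "cadjoint T = word_op T w"
    using SI_adjoint_word[OF SI] by blast
  define P where "P m = prod_list (map (\<lambda>h. cmod (g (m + h))) (word_levels w))" for m
  \<comment> \<open>Testing against \<open>F (m - 1)\<close>, a true basis vector as
    \<open>m \<ge> 1\<close>: its coefficient is nonzero, so the path must end there.\<close>
  have key: "word_deg w = - 1 \<and> P m = cmod (g (m - 1))" if "1 \<le> m" for m
  proof -
    obtain c where c: "cadjoint T (F m) = c *\<^sub>C F (m + word_deg w)" "cmod c = P m"
      using word_op_basis[of F g w m, OF up down] w(2) by (auto simp: P_def)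
    have "g (m - 1) \<noteq> 0" using that nonzero[of "nat (m - 1)"] by (auto simp: g_def)
    moreover have "cnj (g (m - 1)) = c * cinner (F (m + word_deg w)) (F (m - 1))"
    proof -
      have "cinner (F (m - 1)) (F (m - 1)) = 1" using that by (simp add: F_def cinner_basis)
      then show ?thesis
        using c(1) down[of m] by (metis cinner_scaleC_left mult.right_neutral)
    qed
    moreover have "cinner (F i) (F (m - 1)) = (if i = m - 1 then 1 else 0)" for i
      using that by (auto simp: F_def cinner_basis)
    ultimately have "m + word_deg w = m - 1" "cnj (g (m - 1)) = c"
      by (auto split: if_splits)
    then show ?thesis using c(2) complex_mod_cnj[of "g (m - 1)"] by simp
  qed
  obtain M c where M: "\<And>j. M \<le> j \<Longrightarrow> cmod (\<alpha> j) = c"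
    using const unfolding eventually_constant_def by blast
  have "cmod (g (int (Suc n))) = 1"
  proof (rule weights_eq_1[where G = "\<lambda>j. cmod (g j)" and w = w and M = "int M" and c = c])
    show "w \<noteq> [True]" using key[of 1] by auto
    show "prod_list (map (\<lambda>h. cmod (g (m + h))) (word_levels w)) = cmod (g (m - 1))"
      if "1 \<le> m" for m
      using key[OF that] by (simp add: P_def)
  qed (use nonzero M w(1) in \<open>auto simp: g_def\<close>)
  then show ?thesis unfolding g_def by (simp only: nat_int) simp
qed

theorem corollary3p19:
  fixes e :: "nat \<Rightarrow> 'a::complex_hilbert_space"
    and T :: "'a \<Rightarrow> 'a"
    and \<alpha> :: "nat \<Rightarrow> complex"
    and k :: nat
  assumes "weighted_shift e (zeros_then k \<alpha>) T"
    and "eventually_constant (\<lambda>n. cmod (\<alpha> n))"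
    and "\<And>n. cmod (\<alpha> n) \<noteq> 0"
  shows "(SI_semigroup (adjoint_semigroup T) \<longleftrightarrow>
            (\<exists>a. \<forall>n. cmod (\<alpha> n) = (if n = 0 then a else 1))) \<and>
         ((\<exists>a. \<forall>n. cmod (\<alpha> n) = (if n = 0 then a else 1)) \<longrightarrow>
            simple_semigroup (adjoint_semigroup T))"
proof -
  let ?W = "\<exists>a. \<forall>n. cmod (\<alpha> n) = (if n = 0 then a else 1)"
  interpret weighted_shift_operator e "zeros_then k \<alpha>" T
    by unfold_locales (rule assms(1))
  have simple: "simple_semigroup (adjoint_semigroup T)" if ?W
    using that by (intro simple_if_weights) (auto simp: zeros_then_def)
  have "?W" if "SI_semigroup (adjoint_semigroup T)"
  proof (intro exI[of _ "cmod (\<alpha> 0)"] allI)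
    fix n
    show "cmod (\<alpha> n) = (if n = 0 then cmod (\<alpha> 0) else 1)"
      using SI_imp_weights[OF assms that] by (cases n) auto
  qed
  with simple simple_imp_SI show ?thesis by blast
qed

end
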